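(* Let $(A_n)_{n=0}^\infty$ be an Appell sequence with constants $c_k$ defined by $\log f_A(t)=\sum_{k\ge1}c_k\frac{t^k}{k!}$. If $c_k/(k-1)! \in \mathbb{Z}$ for all $k\ge1$, then $A_\lambda \in \mathbb{Z}[x]$ for all partitions $\lambda$.
   Context: An Appell sequence is a sequence of polynomials $(A_n)_{n\ge0}$ with $A_0=1$ and $A_n'=nA_{n-1}$ for $n\ge1$; it satisfies $\sum_k A_k(x)t^k/k!=e^{xt}f_A(t)$ for a formal power series $f_A$ with $f_A(0)=1$. For a partition $\lambda$ of length $r$, let $(n_1,\dots,n_r)=(\lambda_r,\lambda_{r-1}+1,\dots,\lambda_1+r-1)$ and $A_\lambda=\operatorname{Wr}[A_{n_1},\dots,A_{n_r}]/\Delta(n_1,\dots,n_r)$, where $\operatorname{Wr}$ is the Wronskian and $\Delta$ the Vandermonde determinant $\prod_{i<j}(x_j-x_i)$. *)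

theory Defs
  imports "HOL-Computational_Algebra.Polynomial" "HOL-Computational_Algebra.Formal_Power_Series"
    "Jordan_Normal_Form.Determinant"
begin

definition appell :: "(nat \<Rightarrow> 'a::field_char_0 poly) \<Rightarrow> bool" where
  "appell A \<longleftrightarrow> A 0 = 1 \<and> (\<forall>n. pderiv (A (Suc n)) = of_nat (Suc n) * A n)"

text \<open>f_A(t) = sum_k A_k(0) t^k / k!, so that sum_k A_k(x) t^k/k! = e^{xt} f_A(t).\<close>
definition appell_fps :: "(nat \<Rightarrow> 'a::field_char_0 poly) \<Rightarrow> 'a fps" where
  "appell_fps A = Abs_fps (\<lambda>k. poly (A k) 0 / fact k)"

text \<open>Formal logarithm of a series f with f(0)=1: log f = log(1+X) composed with f - 1.\<close>
definition fps_log :: "'a::field_char_0 fps \<Rightarrow> 'a fps" where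
  "fps_log f = fps_compose (fps_ln 1) (f - 1)"

definition appell_const :: "(nat \<Rightarrow> 'a::field_char_0 poly) \<Rightarrow> nat \<Rightarrow> 'a" where
  "appell_const A k = fact k * fps_nth (fps_log (appell_fps A)) k"

definition wronskian :: "nat \<Rightarrow> (nat \<Rightarrow> 'a::field_char_0 poly) \<Rightarrow> 'a poly" where
  "wronskian r f = det (mat r r (\<lambda>(i, j). (pderiv ^^ i) (f j)))"

definition vandermonde :: "nat \<Rightarrow> (nat \<Rightarrow> nat) \<Rightarrow> int" where
  "vandermonde r n = (\<Prod>j<r. \<Prod>i<j. int (n j) - int (n i))"

definition is_partition :: "nat list \<Rightarrow> bool" where
  "is_partition lam \<longleftrightarrow> sorted_wrt (\<ge>) lam \<and> (\<forall>x\<in>set lam. 0 < x)"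

text \<open>(n_1,...,n_r) = (lambda_r, lambda_{r-1}+1, ..., lambda_1 + r - 1), 0-indexed.\<close>
definition part_seq :: "nat list \<Rightarrow> nat \<Rightarrow> nat" where
  "part_seq lam i = lam ! (length lam - 1 - i) + i"

definition appell_schur :: "(nat \<Rightarrow> 'a::field_char_0 poly) \<Rightarrow> nat list \<Rightarrow> 'a poly" where
  "appell_schur A lam =
     smult (1 / of_int (vandermonde (length lam) (part_seq lam)))
       (wronskian (length lam) (\<lambda>j. A (part_seq lam j)))"

end

theory Submission
  imports Defs
begin

text \<open>
  Let \<open>\<psi>(t) = \<Sum>\<^sub>k A\<^sub>k t\<^sup>k / k!\<close>. The hypothesis says that \<open>\<psi>' = v \<psi>\<close> for a power series \<open>v\<close> with
  coefficients in \<open>\<int>[x]\<close>, so multiplication by \<open>\<psi>\<close> intertwines the integral operator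
  \<open>\<nabla> g = g' + v g\<close> with \<open>d/dt\<close>. Let \<open>S\<close> be the backward shift \<open>g \<mapsto> (g - g(0)) / t\<close>, and
  \<open>n\<^sub>0 < n\<^sub>1 < \<dots>\<close>. The functional \<open>G \<mapsto> (\<partial>\<^bsup>m\<^sub>i\<^esup> S \<dots> S \<partial>\<^bsup>m\<^sub>1\<^esup> S \<partial>\<^bsup>m\<^sub>0\<^esup> G)(0)\<close> with \<open>m\<^sub>0 = n\<^sub>0\<close>,
  \<open>m\<^sub>i = n\<^sub>i - n\<^bsub>i-1\<^esub> - 1\<close> picks the coefficient of \<open>t\<close> to the power \<open>n\<^sub>i\<close> in \<open>G\<close>, multiplied by
  \<open>n\<^sub>i! / \<Prod>\<^sub>l\<^sub><\<^sub>i (n\<^sub>i - n\<^sub>l)\<close>; its value on \<open>\<psi> t\<^sup>j\<close> is the \<open>j\<close>-th derivative of \<open>A\<close> with index \<open>n\<^sub>i\<close>,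
  divided by \<open>\<Prod>\<^sub>l\<^sub><\<^sub>i (n\<^sub>i - n\<^sub>l)\<close>. Replacing \<open>\<partial>\<close> by \<open>\<nabla>\<close>, and \<open>\<psi> t\<^sup>j\<close> by \<open>t\<^sup>j\<close>, changes the matrix of
  these values only by a unitriangular factor, because \<open>S (\<psi> g) = \<psi> S g + g(0) S \<psi>\<close>. Hence the
  Wronskian is the Vandermonde determinant times a determinant with entries in \<open>\<int>[x]\<close>.
\<close>

section \<open>Shift towers under multiplication by \<open>\<psi>\<close>\<close>

primrec shift_tower :: "('b::zero fps \<Rightarrow> 'b fps) \<Rightarrow> (nat \<Rightarrow> nat) \<Rightarrow> nat \<Rightarrow> 'b fps \<Rightarrow> 'b fps" where
  "shift_tower D n 0 g = (D ^^ n 0) g"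
| "shift_tower D n (Suc i) g = (D ^^ (n (Suc i) - Suc (n i))) (fps_shift 1 (shift_tower D n i g))"

definition twisted_deriv :: "'b::comm_ring_1 fps \<Rightarrow> 'b fps \<Rightarrow> 'b fps" where
  "twisted_deriv v g = fps_deriv g + v * g"

lemma funpow_fps_deriv_mult_twisted:
  fixes \<psi> v :: "'b::comm_ring_1 fps"
  assumes "fps_deriv \<psi> = v * \<psi>"
  shows "(fps_deriv ^^ m) (\<psi> * g) = \<psi> * (twisted_deriv v ^^ m) g"
  by (induction m) (simp_all add: twisted_deriv_def assms algebra_simps)

lemma funpow_fps_deriv_add:
  "(fps_deriv ^^ m) (f + g) = (fps_deriv ^^ m) f + (fps_deriv ^^ m) (g :: 'b::comm_ring_1 fps)"
  by (induction m) simp_all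

lemma funpow_fps_deriv_sum_const_mult:
  "(fps_deriv ^^ m) (\<Sum>k\<in>K. fps_const (c k) * w k) =
     (\<Sum>k\<in>K. fps_const (c k) * (fps_deriv ^^ m) (w k :: 'b::comm_ring_1 fps))"
  by (induction m) (simp_all add: fps_deriv_sum)

lemma fps_shift_1_mult:
  fixes \<psi> g :: "'b::comm_ring_1 fps"
  shows "fps_shift 1 (\<psi> * g) = \<psi> * fps_shift 1 g + fps_const (fps_nth g 0) * fps_shift 1 \<psi>"
proof (rule fps_ext)
  fix k
  have "fps_nth (fps_shift 1 (\<psi> * g)) k = (\<Sum>i=0..Suc k. fps_nth \<psi> i * fps_nth g (Suc k - i))"
    by (simp add: fps_mult_nth)
  also have "\<dots> = (\<Sum>i=0..k. fps_nth \<psi> i * fps_nth g (Suc (k - i))) + fps_nth \<psi> (Suc k) * fps_nth g 0"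
    by (simp add: Suc_diff_le)
  finally show "fps_nth (fps_shift 1 (\<psi> * g)) k =
      fps_nth (\<psi> * fps_shift 1 g + fps_const (fps_nth g 0) * fps_shift 1 \<psi>) k"
    by (simp add: fps_mult_nth[of \<psi>] mult.commute[of "fps_nth g 0"])
qed

lemma fps_shift_sum_const_mult:
  "fps_shift m (\<Sum>k\<in>K. fps_const (c k) * w k) =
     (\<Sum>k\<in>K. fps_const (c k) * fps_shift m (w k :: 'b::comm_ring_1 fps))"
  by (rule fps_ext) (simp add: fps_sum_nth)

text \<open>Each shift adds one correction, a constant term times a fixed series; later derivatives
  and shifts are linear and carry it along. The series \<open>w\<close> are chosen before
  \<open>g\<close>, so corrections depend on \<open>g\<close> only through scalars, as the matrix
  factorization requires.\<close>

lemma shift_tower_mult_twisted: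
  fixes \<psi> v :: "'b::comm_ring_1 fps"
  assumes \<psi>: "fps_deriv \<psi> = v * \<psi>"
  shows "\<exists>w. \<forall>g. shift_tower fps_deriv n i (\<psi> * g) = \<psi> * shift_tower (twisted_deriv v) n i g
           + (\<Sum>k<i. fps_const (fps_nth (shift_tower (twisted_deriv v) n k g) 0) * w k)"
proof (induction i)
  case 0
  show ?case by (simp add: funpow_fps_deriv_mult_twisted[OF \<psi>])
next
  case (Suc i)
  then obtain w where w: "\<And>g. shift_tower fps_deriv n i (\<psi> * g) =
      \<psi> * shift_tower (twisted_deriv v) n i g
      + (\<Sum>k<i. fps_const (fps_nth (shift_tower (twisted_deriv v) n k g) 0) * w k)"
    by blast
  define m where "m = n (Suc i) - Suc (n i)"
  \<comment> \<open>The shift creates the correction \<open>k = i\<close> from \<open>\<psi>\<close>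
    itself; those with \<open>k < i\<close> come from the previous level.\<close>
  define w' where "w' k = (fps_deriv ^^ m) (fps_shift 1 (if k = i then \<psi> else w k))" for k
  have "shift_tower fps_deriv n (Suc i) (\<psi> * g) = \<psi> * shift_tower (twisted_deriv v) n (Suc i) g
      + (\<Sum>k<Suc i. fps_const (fps_nth (shift_tower (twisted_deriv v) n k g) 0) * w' k)" for g
  proof -
    define c where "c k = fps_nth (shift_tower (twisted_deriv v) n k g) 0" for k
    have "fps_shift 1 (shift_tower fps_deriv n i (\<psi> * g)) =
        \<psi> * fps_shift 1 (shift_tower (twisted_deriv v) n i g)
        + (\<Sum>k<Suc i. fps_const (c k) * fps_shift 1 (if k = i then \<psi> else w k))"
      by (simp add: w fps_shift_add fps_shift_1_mult fps_shift_sum_const_mult add_ac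
          flip: c_def del: One_nat_def)
    then show ?thesis
      unfolding w'_def shift_tower.simps
      by (simp only: funpow_fps_deriv_add funpow_fps_deriv_mult_twisted[OF \<psi>]
          funpow_fps_deriv_sum_const_mult flip: c_def m_def)
  qed
  then show ?case by blast
qed

section \<open>Coefficients read off by the untwisted tower\<close>

lemma fps_nth_funpow_fps_deriv:
  "fact k * fps_nth ((fps_deriv ^^ m) G) k = fact (k + m) * fps_nth (G :: 'b::{comm_ring_1,ring_char_0} fps) (k + m)"
proof (induction m arbitrary: k)
  case (Suc m)
  have "fact k * fps_nth ((fps_deriv ^^ Suc m) G) k =
      fact (Suc k) * fps_nth ((fps_deriv ^^ m) G) (Suc k)"
    by (simp add: algebra_simps)
  also have "\<dots> = fact (k + Suc m) * fps_nth G (k + Suc m)"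
    using Suc.IH[of "Suc k"] by simp
  finally show ?case .
qed simp

text \<open>Differentiating \<open>m\<close> times gives (k+m)!/k!, and the shift skips one index.
  The factor k+m+1 needed to reach (k+m+1)! is the new factor \<open>k + n (Suc i) - n i\<close> of
  the product. Only \<open>k = 0\<close> is used later, but the induction needs every
  \<open>k\<close>.\<close>

lemma shift_tower_fps_deriv_nth:
  fixes G :: "'b::{comm_ring_1,ring_char_0} fps"
  assumes n: "strict_mono_on {..i} n"
  shows "fact k * (\<Prod>l<i. of_nat (k + n i - n l)) * fps_nth (shift_tower fps_deriv n i G) k =
           fact (k + n i) * fps_nth G (k + n i)"
  using n
proof (induction i arbitrary: k)
  case 0
  then show ?case by (simp add: fps_nth_funpow_fps_deriv)
next
  case (Suc i)
  define m where "m = n (Suc i) - Suc (n i)"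
  have "n i < n (Suc i)"
    using Suc.prems by (simp add: strict_mono_on_def)
  then have m: "n (Suc i) = n i + m + 1"
    by (simp add: m_def)
  define T where "T = shift_tower fps_deriv n i G"
  have "fact k * (\<Prod>l<Suc i. of_nat (k + n (Suc i) - n l)) * fps_nth (shift_tower fps_deriv n (Suc i) G) k
      = (\<Prod>l<Suc i. of_nat (k + n (Suc i) - n l)) * (fact k * fps_nth ((fps_deriv ^^ m) (fps_shift 1 T)) k)"
    by (simp add: T_def m_def mult_ac)
  also have "\<dots> = (\<Prod>l<i. of_nat (k + n (Suc i) - n l)) * (of_nat (k + m + 1) * fact (k + m)) * fps_nth T (k + m + 1)"
    by (simp add: fps_nth_funpow_fps_deriv m mult_ac)
  also have "of_nat (k + m + 1) * fact (k + m) = (fact (k + m + 1) :: 'b)"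
    by simp
  also have "(\<Prod>l<i. of_nat (k + n (Suc i) - n l)) * fact (k + m + 1) * fps_nth T (k + m + 1)
      = fact (k + m + 1) * (\<Prod>l<i. of_nat (k + m + 1 + n i - n l)) * fps_nth T (k + m + 1)"
    by (simp add: m mult_ac add_ac)
  also have "\<dots> = fact (k + m + 1 + n i) * fps_nth G (k + m + 1 + n i)"
    unfolding T_def using Suc.prems by (intro Suc.IH) (auto simp: strict_mono_on_def)
  finally show ?case
    by (simp add: m add_ac)
qed

lemma det_fps_coeffs_eq_prod_mult_det:
  fixes \<psi> v :: "'b::{comm_ring_1,ring_char_0} fps"
  assumes \<psi>: "fps_deriv \<psi> = v * \<psi>" "fps_nth \<psi> 0 = 1"
    and n: "strict_mono_on {..<r} n"
  shows "det (mat r r (\<lambda>(i, j). fact (n i) * fps_nth (\<psi> * fps_X ^ j) (n i))) =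
    (\<Prod>i<r. \<Prod>l<i. of_nat (n i - n l)) *
    det (mat r r (\<lambda>(i, j). fps_nth (shift_tower (twisted_deriv v) n i (fps_X ^ j)) 0))"
proof -
  define d :: "nat \<Rightarrow> 'b" where "d i = (\<Prod>l<i. of_nat (n i - n l))" for i
  define ev where "ev i g = fps_nth (shift_tower (twisted_deriv v) n i g) 0" for i g
  have "\<exists>w. \<forall>i g. shift_tower fps_deriv n i (\<psi> * g) = \<psi> * shift_tower (twisted_deriv v) n i g
           + (\<Sum>k<i. fps_const (ev k g) * w i k)"
    unfolding ev_def using shift_tower_mult_twisted[OF \<psi>(1)] by metis
  then obtain w where w: "\<And>i g. shift_tower fps_deriv n i (\<psi> * g) =
      \<psi> * shift_tower (twisted_deriv v) n i g + (\<Sum>k<i. fps_const (ev k g) * w i k)"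
    by blast
  \<comment> \<open>Row \<open>i\<close> holds the constant terms of the corrections; the diagonal
    is 1 because \<open>\<psi>\<close> has constant term 1.\<close>
  define u where "u i k = (if k < i then fps_nth (w i k) 0 else if k = i then 1 else 0)" for i k
  define L where "L = mat r r (\<lambda>(i, k). d i * u i k)"
  define M where "M = mat r r (\<lambda>(i, j). ev i (fps_X ^ j))"
  have entry: "fact (n i) * fps_nth (\<psi> * g) (n i) = (\<Sum>k=0..<r. d i * u i k * ev k g)" if "i < r" for i g
  proof -
    have "strict_mono_on {..i} n"
      using n that by (auto simp: strict_mono_on_def)
    from shift_tower_fps_deriv_nth[OF this, of 0 "\<psi> * g"]
    have "fact (n i) * fps_nth (\<psi> * g) (n i) = d i * fps_nth (shift_tower fps_deriv n i (\<psi> * g)) 0"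
      by (simp add: d_def)
    also have "fps_nth (shift_tower fps_deriv n i (\<psi> * g)) 0 = ev i g + (\<Sum>k<i. u i k * ev k g)"
      by (simp add: w \<psi>(2) fps_sum_nth u_def ev_def mult.commute)
    also have "\<dots> = (\<Sum>k<Suc i. u i k * ev k g)"
      by (simp add: u_def)
    also have "\<dots> = (\<Sum>k=0..<r. u i k * ev k g)"
      using that by (intro sum.mono_neutral_left) (auto simp: u_def)
    finally show ?thesis
      by (simp add: sum_distrib_left mult.assoc)
  qed
  have "mat r r (\<lambda>(i, j). fact (n i) * fps_nth (\<psi> * fps_X ^ j) (n i)) = L * M"
    by (rule eq_matI) (simp_all add: entry L_def M_def scalar_prod_def)
  moreover have "det (L * M) = det L * det M"
    by (rule det_mult[of _ r]) (simp_all add: L_def M_def)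
  moreover have "det L = prod_list (diag_mat L)"
    by (rule det_lower_triangular[of r]) (auto simp: L_def u_def)
  moreover have "prod_list (diag_mat L) = (\<Prod>i<r. d i)"
    by (simp add: prod_list_diag_prod L_def u_def lessThan_atLeast0)
  ultimately show ?thesis
    by (simp add: d_def M_def ev_def)
qed

section \<open>Integrality, as a subset of the polynomials over the field\<close>

definition int_polys :: "'a::field_char_0 poly set" where
  "int_polys = {p. \<forall>i. coeff p i \<in> \<int>}"

lemma int_polys_0: "0 \<in> int_polys"
  and int_polys_1: "1 \<in> int_polys"
  and int_polys_uminus: "p \<in> int_polys \<Longrightarrow> - p \<in> int_polys"
  and int_polys_add: "p \<in> int_polys \<Longrightarrow> q \<in> int_polys \<Longrightarrow> p + q \<in> int_polys"
  and int_polys_mult: "p \<in> int_polys \<Longrightarrow> q \<in> int_polys \<Longrightarrow> p * q \<in> int_polys"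
  by (auto simp: int_polys_def coeff_mult)

lemma int_polys_sum: "(\<And>x. x \<in> X \<Longrightarrow> f x \<in> int_polys) \<Longrightarrow> sum f X \<in> int_polys"
  by (induction X rule: infinite_finite_induct) (auto simp: int_polys_0 int_polys_add)

lemma int_polys_prod: "(\<And>x. x \<in> X \<Longrightarrow> f x \<in> int_polys) \<Longrightarrow> prod f X \<in> int_polys"
  by (induction X rule: infinite_finite_induct) (auto simp: int_polys_1 int_polys_mult)

lemma int_polys_of_nat: "of_nat k \<in> int_polys"
  by (induction k) (auto simp: int_polys_0 int_polys_1 int_polys_add)

lemma int_polys_det:
  assumes "\<And>i j. i < r \<Longrightarrow> j < r \<Longrightarrow> f (i, j) \<in> int_polys"
  shows "det (mat r r f) \<in> int_polys"
proof -
  have "signof \<pi> \<in> int_polys" for \<pi> :: "nat \<Rightarrow> nat"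
    by (simp add: sign_def int_polys_1 int_polys_uminus)
  then show ?thesis
    unfolding det_def'[OF mat_carrier]
    using assms
    by (auto intro!: int_polys_sum int_polys_mult int_polys_prod simp: permutes_in_image)
qed

lemma int_polys_funpow_twisted_deriv:
  assumes "\<And>k. fps_nth v k \<in> int_polys" "\<And>k. fps_nth g k \<in> int_polys"
  shows "fps_nth ((twisted_deriv v ^^ m) g) k \<in> int_polys"
  using assms(2)
proof (induction m arbitrary: k)
  case (Suc m)
  then show ?case
    unfolding funpow.simps o_apply twisted_deriv_def fps_add_nth fps_deriv_nth fps_mult_nth
    by (intro int_polys_add int_polys_mult int_polys_of_nat int_polys_sum assms(1)) auto
qed simp

lemma int_polys_shift_tower_twisted_deriv:
  assumes "\<And>k. fps_nth v k \<in> int_polys" "\<And>k. fps_nth g k \<in> int_polys"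
  shows "fps_nth (shift_tower (twisted_deriv v) n i g) k \<in> int_polys"
  by (induction i arbitrary: k)
     (auto intro!: int_polys_funpow_twisted_deriv assms)

section \<open>Generating function of an Appell sequence\<close>

lemma fps_deriv_fps_log:
  fixes f :: "'a::field_char_0 fps"
  assumes "fps_nth f 0 = 1"
  shows "fps_deriv f = fps_deriv (fps_log f) * f"
proof -
  have "fps_deriv (fps_log f) = (inverse (1 + fps_X) oo (f - 1)) * fps_deriv f"
    using assms by (simp add: fps_log_def fps_compose_deriv fps_ln_deriv)
  also have "inverse (1 + fps_X) oo (f - 1) = inverse ((1 + fps_X) oo (f - 1))"
    using assms by (intro fps_inverse_compose) simp_all
  also have "(1 + fps_X) oo (f - 1) = f"
    using assms by (simp add: fps_compose_add_distrib)
  finally show ?thesis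
    using assms by (simp add: mult_ac inverse_mult_eq_1')
qed

definition appell_egf :: "(nat \<Rightarrow> 'a::field_char_0 poly) \<Rightarrow> 'a poly fps" where
  "appell_egf A = Abs_fps (\<lambda>k. smult (1 / fact k) (A k))"

text \<open>The logarithmic derivative in \<open>t\<close> of e^{xt} f_A(t), namely x + (log f_A)'.
  Its coefficients c_{k+1}/k! are the numbers assumed to be integers.\<close>

definition appell_log_deriv :: "(nat \<Rightarrow> 'a::field_char_0 poly) \<Rightarrow> 'a poly fps" where
  "appell_log_deriv A =
     Abs_fps (\<lambda>k. [:appell_const A (Suc k) / fact k:] + (if k = 0 then [:0, 1:] else 0))"

lemma pderiv_appell_egf_nth:
  assumes "appell A"
  shows "pderiv (fps_nth (appell_egf A) (Suc k)) = fps_nth (appell_egf A) k"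
    and "pderiv (fps_nth (appell_egf A) 0) = 0"
  using assms
  by (simp_all add: appell_egf_def appell_def pderiv_smult of_nat_poly field_simps del: of_nat_Suc)

text \<open>The product with e^{xt} is never formed. The defects \<open>E k\<close> vanish at x = 0,
  where the claim is f' = (log f)' f, and each has the previous one as its derivative in x, so all
  are zero.\<close>

lemma fps_deriv_appell_egf:
  fixes A :: "nat \<Rightarrow> 'a::field_char_0 poly"
  assumes A: "appell A"
  shows "fps_deriv (appell_egf A) = appell_log_deriv A * appell_egf A"
proof (rule fps_ext)
  define h where "h = fps_nth (appell_egf A)"
  define v where "v = fps_nth (appell_log_deriv A)"
  have h': "pderiv (h (Suc k)) = h k" "pderiv (h 0) = 0" for k
    using pderiv_appell_egf_nth[OF A] by (simp_all add: h_def)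
  have v': "pderiv (v k) = (if k = 0 then 1 else 0)" for k
    by (simp add: v_def appell_log_deriv_def pderiv_pCons)
  have h0: "poly (h k) 0 = fps_nth (appell_fps A) k" for k
    by (simp add: h_def appell_egf_def appell_fps_def)
  have v0: "poly (v k) 0 = fps_nth (fps_deriv (fps_log (appell_fps A))) k" for k
    by (simp add: v_def appell_log_deriv_def appell_const_def del: of_nat_Suc)
  have "fps_nth (appell_fps A) 0 = 1"
    using A by (simp add: appell_def appell_fps_def)
  note log = fps_deriv_fps_log[OF this]
  define E where "E k = of_nat (Suc k) * h (Suc k) - (\<Sum>i=0..k. v i * h (k - i))" for k
  have E0: "poly (E k) 0 = 0" for k
  proof -
    have "of_nat (Suc k) * fps_nth (appell_fps A) (Suc k) =
        fps_nth (fps_deriv (fps_log (appell_fps A)) * appell_fps A) k"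
      by (subst log[symmetric]) simp
    then show ?thesis
      by (simp add: E_def poly_sum h0 v0 fps_mult_nth del: of_nat_Suc fps_deriv_nth)
  qed
  \<comment> \<open>Only \<open>v 0\<close> depends on x, so differentiating \<open>v\<close>
    contributes one \<open>h k\<close>, which lowers the factor \<open>Suc k\<close> to
    \<open>k\<close>.\<close>
  have E': "pderiv (E k) = (if k = 0 then 0 else E (k - 1))" for k
  proof -
    have "pderiv (E k) = of_nat (Suc k) * h k - (\<Sum>i=0..k. pderiv (v i * h (k - i)))"
      unfolding E_def pderiv_diff higher_pderiv_sum[of 1, simplified]
      by (simp add: pderiv_mult h' del: of_nat_Suc)
    also have "(\<Sum>i=0..k. pderiv (v i * h (k - i))) =
        (\<Sum>i=0..k. v i * pderiv (h (k - i))) + (\<Sum>i=0..k. pderiv (v i) * h (k - i))"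
      by (simp add: pderiv_mult sum.distrib algebra_simps)
    also have "(\<Sum>i=0..k. pderiv (v i) * h (k - i)) = h k"
      by (simp add: v' if_distrib[where f = "\<lambda>x. x * _"] cong: if_cong)
    also have "(\<Sum>i=0..k. v i * pderiv (h (k - i))) =
        (if k = 0 then 0 else (\<Sum>i=0..k-1. v i * h (k - 1 - i)))"
    proof (cases k)
      case (Suc m)
      have "(\<Sum>i=0..Suc m. v i * pderiv (h (Suc m - i))) = (\<Sum>i=0..m. v i * h (m - i))"
        by (simp add: h' Suc_diff_le)
      then show ?thesis by (simp add: Suc)
    qed (simp add: h')
    finally show ?thesis
      by (cases k) (simp_all add: E_def algebra_simps)
  qed
  have E: "E k = 0" for k
  proof (induction k)
    case (Suc k)
    then show ?case
      using E'[of "Suc k"] E0[of "Suc k"] by (auto dest!: pderiv_iszero)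
  qed (use E'[of 0] E0[of 0] in \<open>auto dest!: pderiv_iszero\<close>)
  show "fps_nth (fps_deriv (appell_egf A)) k = fps_nth (appell_log_deriv A * appell_egf A) k" for k
    using E[of k] by (simp add: E_def fps_mult_nth flip: h_def v_def)
qed

text \<open>On e^{xt} f_A(t), differentiation in x is multiplication by t.\<close>

lemma funpow_pderiv_appell:
  fixes A :: "nat \<Rightarrow> 'a::field_char_0 poly"
  assumes "appell A"
  shows "(pderiv ^^ j) (A k) = fact k * fps_nth (appell_egf A * fps_X ^ j) k"
proof (induction j arbitrary: k)
  case 0
  have "(fact k :: 'a poly) = [:fact k:]"
    by (metis of_nat_fact of_nat_poly)
  then show ?case by (simp add: appell_egf_def)
next
  case (Suc j)
  have "pderiv (fps_nth (appell_egf A * fps_X ^ j) k) = fps_nth (appell_egf A * fps_X ^ Suc j) k"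
  proof (cases "k \<le> j")
    case False
    then have "k - j = Suc (k - Suc j)"
      by simp
    with False show ?thesis
      by (simp add: fps_X_power_mult_right_nth pderiv_appell_egf_nth[OF assms] del: power_Suc)
  next
    case True
    \<comment> \<open>Both sides are 0; for \<open>k = j\<close> because the constant coefficient of
      the generating function does not depend on x.\<close>
    then show ?thesis
      by (cases "k = j")
        (simp_all add: fps_X_power_mult_right_nth pderiv_appell_egf_nth[OF assms] del: power_Suc)
  qed
  moreover have "pderiv (fact k :: 'a poly) = 0"
    by (metis of_nat_fact pderiv_of_nat)
  ultimately show ?case by (simp add: Suc pderiv_mult del: power_Suc)
qed

section \<open>Factorization of the Wronskian\<close>

lemma wronskian_appell:
  fixes A :: "nat \<Rightarrow> 'a::field_char_0 poly"
  assumes "appell A" "strict_mono_on {..<r} n"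
  shows "wronskian r (\<lambda>j. A (n j)) = of_int (vandermonde r n) *
    det (mat r r (\<lambda>(i, j). fps_nth (shift_tower (twisted_deriv (appell_log_deriv A)) n i (fps_X ^ j)) 0))"
    (is "_ = _ * ?D")
proof -
  \<comment> \<open>Transposing makes each row belong to one index \<open>n i\<close>, as in the
    coefficient matrix.\<close>
  have "wronskian r (\<lambda>j. A (n j)) =
      det (transpose_mat (mat r r (\<lambda>(i, j). (pderiv ^^ i) (A (n j)))))"
    by (simp add: wronskian_def det_transpose[of _ r])
  also have "transpose_mat (mat r r (\<lambda>(i, j). (pderiv ^^ i) (A (n j)))) =
      mat r r (\<lambda>(i, j). fact (n i) * fps_nth (appell_egf A * fps_X ^ j) (n i))"
    by (rule eq_matI) (simp_all add: funpow_pderiv_appell[OF assms(1)])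
  also have "det \<dots> = (\<Prod>i<r. \<Prod>l<i. of_nat (n i - n l)) * ?D"
    using assms by (intro det_fps_coeffs_eq_prod_mult_det fps_deriv_appell_egf)
      (simp_all add: appell_egf_def appell_def)
  \<comment> \<open>Monotonicity makes the truncated differences agree with the integer
    ones.\<close>
  also have "(\<Prod>i<r. \<Prod>l<i. of_nat (n i - n l)) = (of_int (vandermonde r n) :: 'a poly)"
    using assms(2) unfolding vandermonde_def of_int_prod
    by (intro prod.cong refl) (auto simp: strict_mono_on_def of_nat_diff less_imp_le)
  finally show ?thesis .
qed

lemma strict_mono_on_part_seq:
  assumes "is_partition lam"
  shows "strict_mono_on {..<length lam} (part_seq lam)"
proof (rule strict_mono_onI)
  fix i j assume "i \<in> {..<length lam}" "j \<in> {..<length lam}" "i < j"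
  then have "lam ! (length lam - 1 - i) \<le> lam ! (length lam - 1 - j)"
    using assms by (auto simp: is_partition_def sorted_wrt_iff_nth_less)
  with \<open>i < j\<close> show "part_seq lam i < part_seq lam j"
    by (simp add: part_seq_def)
qed

lemma vandermonde_nonzero:
  assumes "strict_mono_on {..<r} n"
  shows "vandermonde r n \<noteq> 0"
proof -
  have "int (n j) - int (n i) \<noteq> 0" if "i < j" "j < r" for i j
    using strict_mono_onD[OF assms, of i j] that by simp
  then show ?thesis
    by (simp add: vandermonde_def)
qed

theorem theorem5p8:
  fixes A :: "nat \<Rightarrow> 'a::field_char_0 poly"
  assumes "appell A"
    and "\<forall>k\<ge>1. appell_const A k / fact (k - 1) \<in> \<int>"
  shows "\<forall>lam. is_partition lam \<longrightarrow> (\<forall>i. coeff (appell_schur A lam) i \<in> \<int>)"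
proof (intro allI impI)
  fix lam i assume "is_partition lam"
  then have mono: "strict_mono_on {..<length lam} (part_seq lam)"
    by (rule strict_mono_on_part_seq)
  define D where "D = det (mat (length lam) (length lam) (\<lambda>(i, j). fps_nth
    (shift_tower (twisted_deriv (appell_log_deriv A)) (part_seq lam) i (fps_X ^ j)) 0))"
  have "appell_const A (Suc k) / fact k \<in> \<int>" for k
    using assms(2)[rule_format, of "Suc k"] by simp
  then have "fps_nth (appell_log_deriv A) k \<in> int_polys" for k
    by (auto simp: appell_log_deriv_def int_polys_def coeff_pCons split: nat.split)
  then have "D \<in> int_polys"
    unfolding D_def
    by (auto intro!: int_polys_det int_polys_shift_tower_twisted_deriv simp: int_polys_0 int_polys_1)
  moreover have "appell_schur A lam = D"
    using vandermonde_nonzero[OF mono]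
    by (simp add: appell_schur_def wronskian_appell[OF assms(1) mono] of_int_poly flip: D_def)
  ultimately show "coeff (appell_schur A lam) i \<in> \<int>"
    by (simp add: int_polys_def)
qed

end
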